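(* Let $\mathcal P(U^{3,n})$ be the matroid polytope of the uniform matroid of rank $3$ on $n$ elements, and let $I$ be a non-negative integer. Then there exists $n(I)\in\mathbb N$ such that for all $n\ge n(I)$ the $h^*$-vector $(h^*_0,\dots,h^*_n)$ of $\mathcal P(U^{3,n})$ satisfies $h^*_0\le h^*_1\le\dots\le h^*_I$.
   Context: The uniform matroid $U^{r,n}$ of rank $r$ on $[n]=\{1,\dots,n\}$ has as bases all $r$-element subsets of $[n]$. Its matroid polytope is $\mathcal P(U^{r,n})=\mathrm{conv}\{e_B: B\subseteq[n],|B|=r\}$, where $e_B=\sum_{i\in B}e_i$. For an integral polytope $\mathcal P$ of dimension $d$ with Ehrhart polynomial $i(\mathcal P,k)=\#(k\mathcal P\cap\mathbb Z^n)$ ($i(\mathcal P,0)=1$), its Ehrhart series can be written as $\sum_{k\ge0}i(\mathcal P,k)t^k=\frac{h^*_0+h^*_1t+\dots+h^*_dt^d}{(1-t)^{d+1}}$; the coefficients $h^*_j$ form the $h^*$-vector (with $h^*_j=0$ for $j>d$). *)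

theory Defs
  imports "HOL-Analysis.Analysis" "HOL-Analysis.Finite_Function_Topology"
    "HOL-Computational_Algebra.Formal_Power_Series"
begin

text \<open>
  The ambient space is the space of finitely supported functions from \<^typ>\<open>nat\<close> to \<^typ>\<open>real\<close>,
  in which R^n is the subspace of vectors supported in \<^term>\<open>{1..n}\<close>. This lets n
  vary within a formula. A polytope in R^n has the same convex hull, dimension, dilates and
  lattice points when it is regarded as a subset of the larger space.
\<close>

type_synonym rvec = "nat \<Rightarrow>\<^sub>0 real"

definition unit_vec :: "nat \<Rightarrow> rvec" where
  "unit_vec i = Poly_Mapping.single i 1"

definition uniform_matroid_bases :: "nat \<Rightarrow> nat \<Rightarrow> nat set set" where
  "uniform_matroid_bases r n = {B. B \<subseteq> {1..n} \<and> card B = r}"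

definition matroid_polytope :: "nat set set \<Rightarrow> rvec set" where
  "matroid_polytope \<B> = convex hull ((\<lambda>B. \<Sum>i\<in>B. unit_vec i) ` \<B>)"

definition lattice_points :: "rvec set" where
  "lattice_points = {x. \<forall>i. Poly_Mapping.lookup x i \<in> \<int>}"

definition ehrhart :: "rvec set \<Rightarrow> nat \<Rightarrow> nat" where
  "ehrhart P k = card (((\<lambda>x. real k *\<^sub>R x) ` P) \<inter> lattice_points)"

definition ehrhart_series :: "rvec set \<Rightarrow> int fps" where
  "ehrhart_series P = Abs_fps (\<lambda>k. int (ehrhart P k))"

text \<open>
  The dimension of the affine hull of a nonempty set, as the dimension of its direction space
  (\<^const>\<open>aff_dim\<close> is restricted to Euclidean spaces).
\<close>

definition polytope_dim :: "rvec set \<Rightarrow> nat" where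
  "polytope_dim P = dim {x - y | x y. x \<in> P \<and> y \<in> P}"

text \<open>
  The numerator of the Ehrhart series over the denominator (1 - t)^(d+1), where d is
  the dimension. As 1 - t is a unit in the ring of power series, the numerator is the
  Ehrhart series times (1 - t)^(d+1).
\<close>

definition h_star :: "rvec set \<Rightarrow> nat \<Rightarrow> int" where
  "h_star P j = fps_nth (ehrhart_series P * (1 - fps_X) ^ (polytope_dim P + 1)) j"

end

theory Submission
  imports Defs
begin

text \<open>
  For fixed \<open>k \<ge> 1\<close> and \<open>n \<rightarrow> \<infinity>\<close>, the Ehrhart polynomial of the rank \<open>r\<close> uniform matroid polytope
  is of order \<open>n^(r k)\<close>: a lattice point of the \<open>k\<close>-th dilate is a multiset of size \<open>r k\<close> on
  \<open>n\<close> elements, and every set of size \<open>r k\<close> occurs. Since the coefficient of \<open>t^m\<close> in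
  \<open>(1 - t)^(d+1)\<close> is at most of order \<open>n^m\<close>, the term \<open>i(P, j)\<close> dominates \<open>h\<^sup>*\<^sub>j\<close> when \<open>r \<ge> 2\<close>.
  So \<open>h\<^sup>*\<^sub>j\<close> has order \<open>n^(r j)\<close>, which grows with \<open>j\<close>. Only the bound \<open>d \<le> n\<close> on the dimension
  is needed.
\<close>

section \<open>Coordinates of indicator vectors\<close>

lemma lookup_scaleR [simp]:
  "Poly_Mapping.lookup (c *\<^sub>R x) i = c *\<^sub>R Poly_Mapping.lookup x i"
proof -
  have "finite {i. c *\<^sub>R Poly_Mapping.lookup x i \<noteq> 0}"
    by (rule finite_subset[OF _ finite_keys[of x]]) (auto simp: in_keys_iff)
  then show ?thesis
    by (simp add: scaleR_poly_mapping_def)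
qed

lemma lookup_unit_vec: "Poly_Mapping.lookup (unit_vec i) j = (if i = j then 1 else 0)"
  by (simp add: unit_vec_def lookup_single when_def)

lemma lookup_sum_unit_vec:
  assumes "finite B"
  shows "Poly_Mapping.lookup (\<Sum>i\<in>B. unit_vec i) j = (if j \<in> B then 1 else 0)"
  using assms by (simp add: lookup_sum lookup_unit_vec)

lemma inj_on_sum_unit_vec: "inj_on (\<lambda>B. \<Sum>i\<in>B. unit_vec i) {B. finite B}"
proof (rule inj_onI)
  fix A B :: "nat set"
  assume *: "A \<in> {B. finite B}" "B \<in> {B. finite B}" "(\<Sum>i\<in>A. unit_vec i) = (\<Sum>i\<in>B. unit_vec i)"
  have "j \<in> A \<longleftrightarrow> j \<in> B" for j
    using arg_cong[OF *(3), of "\<lambda>x. Poly_Mapping.lookup x j"] *(1,2)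
    by (simp add: lookup_sum_unit_vec split: if_splits)
  then show "A = B" by blast
qed

section \<open>Outer description and dimension of the polytope\<close>

text \<open>The right side, the \<open>r\<close>-th dilate of a standard simplex, is convex and
  contains every vertex. Its lattice points already give the right order of growth in
  \<open>n\<close>.\<close>

lemma matroid_polytope_uniform_subset:
  "matroid_polytope (uniform_matroid_bases r n) \<subseteq>
    {x. Poly_Mapping.keys x \<subseteq> {1..n} \<and> (\<forall>i. 0 \<le> Poly_Mapping.lookup x i) \<and>
        (\<Sum>i=1..n. Poly_Mapping.lookup x i) = real r}" (is "_ \<subseteq> ?S")
  unfolding matroid_polytope_def
proof (rule hull_minimal)
  show "(\<lambda>B. \<Sum>i\<in>B. unit_vec i) ` uniform_matroid_bases r n \<subseteq> ?S"
  proof safe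
    fix B assume "B \<in> uniform_matroid_bases r n"
    then have B: "B \<subseteq> {1..n}" "card B = r" and fin: "finite B"
      by (auto simp: uniform_matroid_bases_def intro: finite_subset)
    show "i \<in> {1..n}" if "i \<in> Poly_Mapping.keys (\<Sum>i\<in>B. unit_vec i)" for i
      using that B fin by (auto simp: in_keys_iff lookup_sum_unit_vec split: if_splits)
    show "0 \<le> Poly_Mapping.lookup (\<Sum>i\<in>B. unit_vec i) i" for i
      using fin by (simp add: lookup_sum_unit_vec)
    have "(\<Sum>i=1..n. Poly_Mapping.lookup (\<Sum>i\<in>B. unit_vec i) i) = real (card ({1..n} \<inter> B))"
      using fin by (simp add: lookup_sum_unit_vec flip: sum.inter_restrict)
    then show "(\<Sum>i=1..n. Poly_Mapping.lookup (\<Sum>i\<in>B. unit_vec i) i) = real r"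
      using B by (simp add: Int_absorb1)
  qed
  show "convex ?S"
  proof (rule convexI)
    fix x y :: rvec and u v :: real
    assume x: "x \<in> ?S" and y: "y \<in> ?S" and uv: "0 \<le> u" "0 \<le> v" "u + v = 1"
    have "Poly_Mapping.keys (u *\<^sub>R x + v *\<^sub>R y) \<subseteq> Poly_Mapping.keys x \<union> Poly_Mapping.keys y"
      by (auto simp: in_keys_iff lookup_add)
    moreover have "(\<Sum>i=1..n. Poly_Mapping.lookup (u *\<^sub>R x + v *\<^sub>R y) i) = u * real r + v * real r"
      using x y by (simp add: lookup_add sum.distrib flip: sum_distrib_left)
    moreover have "u * real r + v * real r = real r"
      using uv by (simp flip: distrib_right)
    ultimately show "u *\<^sub>R x + v *\<^sub>R y \<in> ?S"
      using x y uv by (auto simp: lookup_add)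
  qed
qed

text \<open>Differences of points of the polytope are supported in \<open>{1..n}\<close>, hence lie
  in the span of \<open>n\<close> unit vectors.\<close>

lemma polytope_dim_uniform_le:
  "polytope_dim (matroid_polytope (uniform_matroid_bases r n)) \<le> n"
proof -
  let ?P = "matroid_polytope (uniform_matroid_bases r n)"
  have "z \<in> span (unit_vec ` {1..n})" if "Poly_Mapping.keys z \<subseteq> {1..n}" for z :: rvec
  proof -
    have "z = (\<Sum>i=1..n. Poly_Mapping.lookup z i *\<^sub>R unit_vec i)"
    proof (rule poly_mapping_eqI)
      fix j
      show "Poly_Mapping.lookup z j =
          Poly_Mapping.lookup (\<Sum>i=1..n. Poly_Mapping.lookup z i *\<^sub>R unit_vec i) j"
        using that by (auto simp: lookup_sum lookup_unit_vec in_keys_iff if_distrib cong: if_cong)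
    qed
    moreover have "(\<Sum>i=1..n. Poly_Mapping.lookup z i *\<^sub>R unit_vec i) \<in> span (unit_vec ` {1..n})"
      by (intro span_sum span_scale span_base) auto
    ultimately show ?thesis by simp
  qed
  moreover have "Poly_Mapping.keys (x - y) \<subseteq> {1..n}" if "x \<in> ?P" "y \<in> ?P" for x y
  proof -
    have "Poly_Mapping.keys x \<subseteq> {1..n}" "Poly_Mapping.keys y \<subseteq> {1..n}"
      using that matroid_polytope_uniform_subset by blast+
    then show ?thesis
      using keys_diff[of x y] by blast
  qed
  ultimately have "{x - y | x y. x \<in> ?P \<and> y \<in> ?P} \<subseteq> span (unit_vec ` {1..n})"
    by blast
  then have "polytope_dim ?P \<le> card (unit_vec ` {1..n})"
    unfolding polytope_dim_def by (rule dim_le_card) simp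
  also have "\<dots> \<le> n"
    using card_image_le[of "{1..n}" unit_vec] by simp
  finally show ?thesis .
qed

section \<open>Upper bound for the Ehrhart function\<close>

text \<open>Unit vectors are peeled off one at a time: a nonzero coordinate is a positive integer,
  so lowering it by 1 keeps the point nonnegative. Lists stand in for multisets because they are
  counted by a plain power.\<close>

lemma nonneg_lattice_point_eq_sum_list:
  assumes "finite A" "x \<in> lattice_points" "Poly_Mapping.keys x \<subseteq> A"
    "\<And>i. 0 \<le> Poly_Mapping.lookup x i" "(\<Sum>i\<in>A. Poly_Mapping.lookup x i) = real m"
  shows "\<exists>l. set l \<subseteq> A \<and> length l = m \<and> x = sum_list (map unit_vec l)"
  using assms(2-)
proof (induction m arbitrary: x)
  case 0
  then have "\<forall>i\<in>A. Poly_Mapping.lookup x i = 0"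
    using \<open>finite A\<close> sum_nonneg_eq_0_iff[of A "Poly_Mapping.lookup x"] by simp
  then have "x = 0"
    using 0 by (metis disjoint_iff in_keys_iff keys_eq_empty subset_empty subset_eq ex_in_conv)
  then show ?case by auto
next
  case (Suc m)
  obtain i where i: "i \<in> A" "Poly_Mapping.lookup x i \<noteq> 0"
    using Suc.prems(4) by (metis of_nat_eq_0_iff old.nat.distinct(2) sum.neutral)
  obtain z :: int where z: "Poly_Mapping.lookup x i = of_int z"
    using Suc.prems(1) by (auto simp: lattice_points_def elim: Ints_cases)
  have "z \<ge> 1"
    using i z Suc.prems(3)[of i] by simp
  then have ge1: "Poly_Mapping.lookup x i \<ge> 1"
    using z by simp
  let ?y = "x - unit_vec i"
  have "\<exists>l. set l \<subseteq> A \<and> length l = m \<and> ?y = sum_list (map unit_vec l)"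
  proof (rule Suc.IH)
    show "?y \<in> lattice_points"
      using Suc.prems(1) by (auto simp: lattice_points_def lookup_minus lookup_unit_vec)
    show "Poly_Mapping.keys ?y \<subseteq> A"
      using Suc.prems(2) i by (auto simp: in_keys_iff lookup_minus lookup_unit_vec split: if_splits)
    show "0 \<le> Poly_Mapping.lookup ?y j" for j
      using Suc.prems(3)[of j] ge1 by (auto simp add: lookup_minus lookup_unit_vec)
    show "(\<Sum>i\<in>A. Poly_Mapping.lookup ?y i) = real m"
      using Suc.prems(4) i \<open>finite A\<close> by (simp add: lookup_minus lookup_unit_vec sum_subtractf)
  qed
  then obtain l where "set l \<subseteq> A" "length l = m" "?y = sum_list (map unit_vec l)"
    by blast
  then have "set (i # l) \<subseteq> A \<and> length (i # l) = Suc m \<and> x = sum_list (map unit_vec (i # l))"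
    using i by (auto simp: algebra_simps)
  then show ?case by blast
qed

lemma lattice_points_dilate_uniform_subset:
  "((\<lambda>x. real k *\<^sub>R x) ` matroid_polytope (uniform_matroid_bases r n)) \<inter> lattice_points \<subseteq>
    (\<lambda>l. sum_list (map unit_vec l)) ` {l. set l \<subseteq> {1..n} \<and> length l = r * k}"
proof safe
  fix x
  assume x: "x \<in> matroid_polytope (uniform_matroid_bases r n)" and lat: "real k *\<^sub>R x \<in> lattice_points"
  have *: "Poly_Mapping.keys x \<subseteq> {1..n}" "\<And>i. 0 \<le> Poly_Mapping.lookup x i"
    "(\<Sum>i=1..n. Poly_Mapping.lookup x i) = real r"
    using x matroid_polytope_uniform_subset by blast+
  have "\<exists>l. set l \<subseteq> {1..n} \<and> length l = r * k \<and> real k *\<^sub>R x = sum_list (map unit_vec l)"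
  proof (rule nonneg_lattice_point_eq_sum_list[OF _ lat])
    show "Poly_Mapping.keys (real k *\<^sub>R x) \<subseteq> {1..n}"
      using *(1) by (auto simp: in_keys_iff)
    show "(\<Sum>i=1..n. Poly_Mapping.lookup (real k *\<^sub>R x) i) = real (r * k)"
      using *(3) by (simp flip: sum_distrib_left)
  qed (use *(2) in auto)
  then show "real k *\<^sub>R x \<in> (\<lambda>l. sum_list (map unit_vec l)) ` {l. set l \<subseteq> {1..n} \<and> length l = r * k}"
    by blast
qed

lemma finite_lattice_points_dilate_uniform:
  "finite (((\<lambda>x. real k *\<^sub>R x) ` matroid_polytope (uniform_matroid_bases r n)) \<inter> lattice_points)"
  by (rule finite_subset[OF lattice_points_dilate_uniform_subset])
    (simp add: finite_lists_length_eq)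

lemma ehrhart_uniform_le:
  "ehrhart (matroid_polytope (uniform_matroid_bases r n)) k \<le> n ^ (r * k)"
proof -
  let ?L = "{l. set l \<subseteq> {1..n} \<and> length l = r * k}"
  have "ehrhart (matroid_polytope (uniform_matroid_bases r n)) k
      \<le> card ((\<lambda>l. sum_list (map unit_vec l)) ` ?L)"
    unfolding ehrhart_def
    by (rule card_mono[OF _ lattice_points_dilate_uniform_subset])
      (simp add: finite_lists_length_eq)
  also have "\<dots> \<le> card ?L"
    by (rule card_image_le) (simp add: finite_lists_length_eq)
  also have "\<dots> = n ^ (r * k)"
    by (simp add: card_lists_length_eq)
  finally show ?thesis .
qed

section \<open>Lower bound for the Ehrhart function\<close>

text \<open>Cutting \<open>S\<close> into \<open>k\<close> blocks of size \<open>r\<close> writes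
  its indicator vector as a sum of \<open>k\<close> vertices, that is, \<open>k\<close> times their
  average. For \<open>k = 0\<close> and \<open>r > n\<close> the claim fails, as the polytope is
  empty.\<close>

lemma sum_unit_vec_mem_dilate_uniform:
  assumes "k \<ge> 1" "S \<subseteq> {1..n}" "card S = r * k"
  shows "(\<Sum>i\<in>S. unit_vec i) \<in> (\<lambda>x. real k *\<^sub>R x) ` matroid_polytope (uniform_matroid_bases r n)"
  using assms
proof (induction k arbitrary: S rule: nat_induct_at_least)
  case base
  then have "(\<Sum>i\<in>S. unit_vec i) \<in> matroid_polytope (uniform_matroid_bases r n)"
    unfolding matroid_polytope_def by (intro hull_inc) (auto simp: uniform_matroid_bases_def)
  then show ?case by simp
next
  case (Suc k)
  let ?P = "matroid_polytope (uniform_matroid_bases r n)"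
  have "r \<le> card S"
    using Suc.prems by simp
  then obtain B where B: "B \<subseteq> S" "card B = r" "finite B"
    by (rule obtain_subset_with_card_n)
  have "finite S"
    using Suc.prems by (auto intro: finite_subset)
  have "card (S - B) = r * k"
    using B Suc.prems by (simp add: card_Diff_subset)
  then obtain p where p: "p \<in> ?P" "(\<Sum>i\<in>S - B. unit_vec i) = real k *\<^sub>R p"
    using Suc.IH[of "S - B"] Suc.prems by auto
  define q where "q = (\<Sum>i\<in>B. unit_vec i)"
  have q: "q \<in> ?P"
    unfolding matroid_polytope_def q_def
    using B Suc.prems by (intro hull_inc) (auto simp: uniform_matroid_bases_def)
  \<comment> \<open>The weight of the new block \<open>B\<close> in the average of
    \<open>Suc k\<close> vertices; \<open>p\<close>, the average of the other \<open>k\<close>, gets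
    weight \<open>real k * u\<close>.\<close>
  define u where "u = 1 / real (Suc k)"
  have "(real k * u) *\<^sub>R p + u *\<^sub>R q \<in> ?P"
  proof (rule convexD[OF _ p(1) q])
    show "convex ?P"
      by (simp add: matroid_polytope_def)
  qed (auto simp: u_def field_simps)
  moreover have "(\<Sum>i\<in>S. unit_vec i) = real (Suc k) *\<^sub>R ((real k * u) *\<^sub>R p + u *\<^sub>R q)"
  proof -
    have "(\<Sum>i\<in>S. unit_vec i) = real k *\<^sub>R p + q"
      using sum.subset_diff[OF B(1) \<open>finite S\<close>, of unit_vec] p(2) by (simp add: q_def)
    moreover have "real (Suc k) * (real k * u) = real k" "real (Suc k) * u = 1"
      by (simp_all add: u_def)
    ultimately show ?thesis
      by (simp only: scaleR_add_right scaleR_scaleR scaleR_one)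
  qed
  ultimately show ?case by blast
qed

text \<open>Distinct sets of size \<open>r * k\<close> have distinct indicator vectors, all of them
  lattice points of the dilate.\<close>

lemma ehrhart_uniform_ge:
  assumes "k \<ge> 1"
  shows "n choose (r * k) \<le> ehrhart (matroid_polytope (uniform_matroid_bases r n)) k"
proof -
  let ?F = "{S. S \<subseteq> {1..n} \<and> card S = r * k}"
  have sub: "?F \<subseteq> {B. finite B}"
    by (auto intro: finite_subset)
  have "n choose (r * k) = card ?F"
    using n_subsets[of "{1..n}" "r * k"] by simp
  also have "\<dots> = card ((\<lambda>S. \<Sum>i\<in>S. unit_vec i) ` ?F)"
    using card_image[OF inj_on_subset[OF inj_on_sum_unit_vec sub]] by simp
  also have "\<dots> \<le> ehrhart (matroid_polytope (uniform_matroid_bases r n)) k"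
    unfolding ehrhart_def
  proof (rule card_mono[OF finite_lattice_points_dilate_uniform], intro image_subsetI IntI)
    fix S assume S: "S \<in> ?F"
    then show "(\<Sum>i\<in>S. unit_vec i) \<in> (\<lambda>x. real k *\<^sub>R x) ` matroid_polytope (uniform_matroid_bases r n)"
      using assms by (intro sum_unit_vec_mem_dilate_uniform) auto
    show "(\<Sum>i\<in>S. unit_vec i) \<in> lattice_points"
      using S sub by (auto simp: lattice_points_def lookup_sum_unit_vec subset_iff)
  qed
  finally show ?thesis .
qed

section \<open>Estimates for the h*-vector\<close>

text \<open>Up to sign the coefficient is a binomial coefficient. The induction uses Pascal's rule:
  a factor \<open>1 - fps_X\<close> subtracts from each coefficient its predecessor.\<close>

lemma abs_nth_one_minus_X_power_le:
  "\<bar>fps_nth ((1 - fps_X :: int fps) ^ d) m\<bar> \<le> int d ^ m"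
proof (induction d arbitrary: m)
  case 0
  show ?case by (cases m) auto
next
  case (Suc d)
  show ?case
  proof (cases m)
    case 0
    then show ?thesis
      using Suc.IH[of 0] by (simp add: left_diff_distrib)
  next
    case (Suc m')
    have "\<bar>fps_nth ((1 - fps_X :: int fps) ^ Suc d) m\<bar>
        = \<bar>fps_nth ((1 - fps_X :: int fps) ^ d) (Suc m') - fps_nth ((1 - fps_X) ^ d) m'\<bar>"
      by (simp add: Suc left_diff_distrib)
    also have "\<dots> \<le> int d ^ Suc m' + int d ^ m'"
      using Suc.IH[of "Suc m'"] Suc.IH[of m'] by linarith
    also have "\<dots> = (int d + 1) * int d ^ m'"
      by (simp add: algebra_simps)
    also have "\<dots> \<le> (int d + 1) * (int d + 1) ^ m'"
      by (intro mult_left_mono power_mono) auto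
    also have "\<dots> = int (Suc d) ^ m"
      by (simp add: Suc add.commute)
    finally show ?thesis .
  qed
qed

text \<open>The Ehrhart number contributes the exponent \<open>r * i\<close> and the coefficient the
  exponent \<open>m\<close>; the base is \<open>Suc n\<close> because
  \<open>polytope_dim P + 1\<close> is at most \<open>n + 1\<close>.\<close>

lemma h_star_summand_le:
  fixes r n i m :: nat
  defines "P \<equiv> matroid_polytope (uniform_matroid_bases r n)"
  shows "\<bar>int (ehrhart P i) * fps_nth ((1 - fps_X :: int fps) ^ (polytope_dim P + 1)) m\<bar>
    \<le> int (Suc n) ^ (r * i + m)"
proof -
  have "int (ehrhart P i) \<le> int (Suc n) ^ (r * i)"
  proof -
    have "ehrhart P i \<le> Suc n ^ (r * i)"
      using ehrhart_uniform_le[of r n i] power_mono[of n "Suc n" "r * i"]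
      unfolding P_def by linarith
    then show ?thesis
      by (metis of_nat_le_iff of_nat_power)
  qed
  moreover have "\<bar>fps_nth ((1 - fps_X :: int fps) ^ (polytope_dim P + 1)) m\<bar> \<le> int (Suc n) ^ m"
  proof -
    have "int (polytope_dim P + 1) ^ m \<le> int (Suc n) ^ m"
      using polytope_dim_uniform_le[of r n] unfolding P_def by (intro power_mono) auto
    then show ?thesis
      using abs_nth_one_minus_X_power_le order_trans by blast
  qed
  ultimately show ?thesis
    unfolding abs_mult power_add by (intro mult_mono) auto
qed

lemma h_star_conv_sum:
  "h_star P j = (\<Sum>i=0..j. int (ehrhart P i) *
     fps_nth ((1 - fps_X :: int fps) ^ (polytope_dim P + 1)) (j - i))"
  by (simp only: h_star_def fps_mult_nth ehrhart_series_def fps_nth_Abs_fps)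

lemma h_star_uniform_le:
  assumes "r \<ge> 1"
  shows "h_star (matroid_polytope (uniform_matroid_bases r n)) j \<le> int (Suc j) * int (Suc n) ^ (r * j)"
proof -
  let ?P = "matroid_polytope (uniform_matroid_bases r n)"
  have "h_star ?P j \<le> (\<Sum>i=0..j. int (Suc n) ^ (r * j))"
    unfolding h_star_conv_sum
  proof (rule sum_mono)
    fix i assume "i \<in> {0..j}"
    then obtain m where j: "j = i + m"
      by (metis atLeastAtMost_iff le_Suc_ex)
    \<comment> \<open>Each step from \<open>i\<close> towards \<open>j\<close> trades a factor of
      order \<open>n\<close> for one of order \<open>n^r\<close>, so \<open>i = j\<close> gives the
      largest bound.\<close>
    have "r * i + m \<le> r * j"
      using assms by (simp add: j distrib_left)
    then have "int (Suc n) ^ (r * i + m) \<le> int (Suc n) ^ (r * j)"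
      by (intro power_increasing) auto
    then show "int (ehrhart ?P i) * fps_nth ((1 - fps_X :: int fps) ^ (polytope_dim ?P + 1)) (j - i)
        \<le> int (Suc n) ^ (r * j)"
      using h_star_summand_le[of r n i m] by (simp only: j add_diff_cancel_left')
  qed
  then show ?thesis by simp
qed

text \<open>The last summand of the convolution is the Ehrhart number at \<open>Suc j\<close>, since
  \<open>(1 - t)^(d+1)\<close> has constant term 1. Each of the other \<open>Suc j\<close> summands
  has absolute value at most \<open>Suc n ^ (r * j + 1)\<close>.\<close>

lemma h_star_uniform_Suc_ge:
  assumes "r \<ge> 1"
  shows "int (n choose (r * Suc j)) - int (Suc j) * int (Suc n) ^ (r * j + 1)
    \<le> h_star (matroid_polytope (uniform_matroid_bases r n)) (Suc j)"
proof -
  let ?P = "matroid_polytope (uniform_matroid_bases r n)"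
  let ?t = "\<lambda>i. int (ehrhart ?P i) *
    fps_nth ((1 - fps_X :: int fps) ^ (polytope_dim ?P + 1)) (Suc j - i)"
  have "- (\<Sum>i=0..j. int (Suc n) ^ (r * j + 1)) \<le> (\<Sum>i=0..j. ?t i)"
    unfolding sum_negf[symmetric]
  proof (rule sum_mono)
    fix i assume "i \<in> {0..j}"
    then obtain m where j: "j = i + m"
      by (metis atLeastAtMost_iff le_Suc_ex)
    have "r * i + Suc m \<le> r * j + 1"
      using assms by (simp add: j distrib_left)
    then have "int (Suc n) ^ (r * i + Suc m) \<le> int (Suc n) ^ (r * j + 1)"
      by (intro power_increasing) auto
    moreover have "Suc j - i = Suc m"
      by (simp add: j)
    ultimately show "- (int (Suc n) ^ (r * j + 1)) \<le> ?t i"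
      using h_star_summand_le[of r n i "Suc m"] by (simp only:)
  qed
  moreover have "int (n choose (r * Suc j)) \<le> ?t (Suc j)"
    using ehrhart_uniform_ge[of "Suc j" n r] by (simp add: fps_nth_power_0)
  moreover have "h_star ?P (Suc j) = (\<Sum>i=0..j. ?t i) + ?t (Suc j)"
    unfolding h_star_conv_sum by (rule sum.atLeast0_atMost_Suc)
  ultimately show ?thesis by simp
qed

section \<open>Comparison of growth rates\<close>

lemma choose_dominates_power:
  fixes a c K :: nat
  assumes "a < K"
  shows "\<forall>\<^sub>F n in sequentially. c * Suc n ^ a \<le> n choose K"
proof -
  \<comment> \<open>The factor \<open>2 ^ a\<close> pays for \<open>Suc n \<le> 2 * n\<close>, and
    \<open>K ^ K\<close> for the denominator in \<open>(n / K) ^ K \<le> n choose K\<close>. The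
    added \<open>K\<close> ensures \<open>K \<le> n\<close>.\<close>
  have "c * Suc n ^ a \<le> n choose K" if n: "n \<ge> 2 ^ a * c * K ^ K + K" for n
  proof -
    have "K \<le> n" "K > 0"
      using n assms by auto
    then have "(real n / real K) ^ K \<le> real (n choose K)"
      using binomial_ge_n_over_k_pow_k[of K n, where 'a = real] by simp
    then have "real n ^ K \<le> real (n choose K) * real K ^ K"
      using \<open>K > 0\<close> by (simp add: power_divide field_simps)
    then have up: "n ^ K \<le> (n choose K) * K ^ K"
      by (metis of_nat_le_iff of_nat_mult of_nat_power)
    have "(c * Suc n ^ a) * K ^ K \<le> (c * (2 * n) ^ a) * K ^ K"
      using \<open>K \<le> n\<close> \<open>K > 0\<close> by (intro mult_mono power_mono) auto
    also have "\<dots> = (2 ^ a * c * K ^ K) * n ^ a"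
      by (simp add: power_mult_distrib)
    also have "\<dots> \<le> n * n ^ a"
      using n by (intro mult_right_mono) auto
    also have "\<dots> \<le> n ^ K"
      using assms \<open>K \<le> n\<close> \<open>K > 0\<close> power_increasing[of "Suc a" K n] by simp
    also note up
    finally show ?thesis
      using \<open>K > 0\<close> by simp
  qed
  then show ?thesis
    by (auto simp: eventually_sequentially)
qed

lemma eventually_h_star_uniform_le_Suc:
  assumes "r \<ge> 2"
  shows "\<forall>\<^sub>F n in sequentially. h_star (matroid_polytope (uniform_matroid_bases r n)) j
    \<le> h_star (matroid_polytope (uniform_matroid_bases r n)) (Suc j)"
proof -
  \<comment> \<open>This strict gap between the exponents is exactly the condition
    \<open>r \<ge> 2\<close>.\<close>
  have "r * j + 1 < r * Suc j"
    using assms by simp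
  \<comment> \<open>One half of the factor \<open>2 * Suc j\<close> covers the upper bound for the
    entry at \<open>j\<close>, the other half the error term in the lower bound for the entry at
    \<open>Suc j\<close>.\<close>
  from choose_dominates_power[OF this, of "2 * Suc j"] show ?thesis
  proof eventually_elim
    case (elim n)
    let ?h = "h_star (matroid_polytope (uniform_matroid_bases r n))"
    have "?h j \<le> int (Suc j) * int (Suc n) ^ (r * j)"
      using assms by (intro h_star_uniform_le) auto
    also have "\<dots> \<le> int (Suc j) * int (Suc n) ^ (r * j + 1)"
      by (intro mult_left_mono power_increasing) auto
    also have "\<dots> \<le> int (n choose (r * Suc j)) - int (Suc j) * int (Suc n) ^ (r * j + 1)"
    proof -
      have "int (2 * Suc j * Suc n ^ (r * j + 1)) \<le> int (n choose (r * Suc j))"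
        using elim by (simp only: of_nat_le_iff)
      moreover have "int (2 * Suc j * Suc n ^ (r * j + 1)) =
          2 * (int (Suc j) * int (Suc n) ^ (r * j + 1))"
        by (simp only: of_nat_mult of_nat_power of_nat_numeral mult.assoc)
      ultimately show ?thesis by linarith
    qed
    also have "\<dots> \<le> ?h (Suc j)"
      using assms by (intro h_star_uniform_Suc_ge) auto
    finally show ?case .
  qed
qed

theorem theorem1p3:
  fixes I :: nat
  shows "\<exists>N::nat. \<forall>n\<ge>N. \<forall>j<I.
    h_star (matroid_polytope (uniform_matroid_bases 3 n)) j
      \<le> h_star (matroid_polytope (uniform_matroid_bases 3 n)) (Suc j)"
proof -
  have "\<forall>\<^sub>F n in sequentially. \<forall>j\<in>{..<I}.
    h_star (matroid_polytope (uniform_matroid_bases 3 n)) j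
      \<le> h_star (matroid_polytope (uniform_matroid_bases 3 n)) (Suc j)"
    \<comment> \<open>Only finitely many \<open>j\<close> occur, so their thresholds combine into
      one.\<close>
    by (intro eventually_ball_finite ballI eventually_h_star_uniform_le_Suc) auto
  then show ?thesis
    by (auto simp: eventually_sequentially)
qed

end
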